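(* Let $X$ be a separable infinite-dimensional Banach space, let $d\geq 1$, let $\gamma>0$ and let $\Lambda$ be a compact subset of $\mathbb R^d$ having homogeneous box dimension at most $\gamma$. Let $(T_\lambda)_{\lambda\in\Lambda}$ be a family of bounded linear operators on $X$ such that the map $(\lambda,u)\mapsto T_\lambda u$ is continuous from $\Lambda\times X$ into $X$, and let $\mathcal D\subset X$ be a dense set such that for each $\lambda\in\Lambda$ there is a map $S_\lambda:\mathcal D\to\mathcal D$ with $T_\lambda S_\lambda u=u$ for all $u\in\mathcal D$. Assume moreover that there exist $\alpha\in(0,1/\gamma)$, $\beta>\alpha\gamma$ and $D>0$ such that, for all $u\in\mathcal D$, (a) there exist $C>0$ and $N>0$ such that, for all $\lambda,\mu\in\Lambda$ and all integers $n\ge0$ and $k\ge N$ with $\|\lambda-\mu\|\le D\frac{k^\alpha}{(n+k)^\alpha}$, $$\left\|T_\lambda^{n+k}S_\mu^nu\right\|\le\frac{C}{k^\beta}\quad\text{and}\quad\left\|T_\lambda^{n}S_\mu^{n+k}u\right\|\le\frac{C}{k^\beta};$$ (b) for all $\varepsilon>0$ there exists $\tau>0$ such that, for all $n\ge1$ and all $\lambda,\mu\in\Lambda$, $$\|\lambda-\mu\|\le\frac{\tau}{n^\alpha}\implies\left\|T_\lambda^nS_\mu^nu-u\right\|<\varepsilon.$$ Then $\bigcap_{\lambda\in\Lambda}HC(T_\lambda)$ is a dense $G_\delta$ subset of $X$.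
   Context: $\mathbb R^d$ is endowed with the sup-norm. $HC(T)$ is the set of vectors $x\in X$ whose orbit $\{T^nx:n\ge0\}$ is dense in $X$. For $r\ge1$ put $I_r=\{1,\dots,r\}$. A compact set $\Lambda\subset\mathbb R^d$ has homogeneous box dimension at most $\gamma\in(0,d]$ if there exist an integer $r\ge2$, a constant $C(\Lambda)>0$ and, for all $m\ge1$, a family $(\Lambda_{\mathbf k})_{\mathbf k\in I_r^m}$ of compact subsets of $\Lambda$ such that for all $m\ge1$: (1) $\operatorname{diam}(\Lambda_{\mathbf k})\le C(\Lambda)\left(\frac{1}{r^{1/\gamma}}\right)^m$ for all $\mathbf k\in I_r^m$; (2) $\Lambda\subset\bigcup_{\mathbf k\in I_r^m}\Lambda_{\mathbf k}$; (3) $\Lambda_{k_1,\dots,k_m}\subset\Lambda_{k_1,\dots,k_{m-1}}$ for all $\mathbf k=(k_1,\dots,k_m)\in I_r^m$ (for $m=1$ the right-hand side is $\Lambda$). *)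

theory Defs
  imports "HOL-Analysis.Analysis"
begin

definition hypercyclic_vectors :: "('a::topological_space \<Rightarrow> 'a) \<Rightarrow> 'a set" where
  "hypercyclic_vectors T = {x. closure (range (\<lambda>n. (T ^^ n) x)) = UNIV}"

(* The library norm on real ^ 'd is Euclidean; the sup-norm is infnorm.  The diameter
   below is the library's diameter with dist x y replaced by infnorm (x - y). *)
definition sup_diameter :: "(real ^ 'd) set \<Rightarrow> real" where
  "sup_diameter S = (if S = {} then 0 else SUP (x, y)\<in>S \<times> S. infnorm (x - y))"

definition index_words :: "nat \<Rightarrow> nat \<Rightarrow> nat list set" where
  "index_words r m = {k. length k = m \<and> set k \<subseteq> {1..r}}"

(* The families for the different m are merged into one function L on words, as words of
   different lengths are different lists.  For m = 1 the nesting condition has Lambda on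
   its right-hand side, so it is already contained in L k \<subseteq> \<Lambda>. *)
definition homogeneous_box_dim_at_most :: "(real ^ 'd) set \<Rightarrow> real \<Rightarrow> bool" where
  "homogeneous_box_dim_at_most \<Lambda> \<gamma> \<longleftrightarrow>
     compact \<Lambda> \<and> 0 < \<gamma> \<and> \<gamma> \<le> real CARD('d) \<and>
     (\<exists>(r::nat) (C::real) (L :: nat list \<Rightarrow> (real ^ 'd) set).
        2 \<le> r \<and> 0 < C \<and>
        (\<forall>m\<ge>1.
           (\<forall>k\<in>index_words r m. compact (L k) \<and> L k \<subseteq> \<Lambda>) \<and>
           (\<forall>k\<in>index_words r m. sup_diameter (L k) \<le> C * (1 / real r powr (1 / \<gamma>)) ^ m) \<and>
           \<Lambda> \<subseteq> (\<Union>k\<in>index_words r m. L k) \<and>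
           (\<forall>k\<in>index_words r m. 2 \<le> m \<longrightarrow> L k \<subseteq> L (butlast k))))"

end

theory Submission
  imports Defs
begin

text \<open>
  By the Baire category theorem it suffices to approximate, on each piece \<open>K\<close> of a countable cover of
  \<open>\<Lambda>\<close> by compact sets, any \<open>u \<in> \<D>\<close> by a vector whose \<open>T\<^sub>\<lambda>\<close>-orbit comes close to
  \<open>v \<in> \<D>\<close> for all \<open>\<lambda> \<in> K\<close>. Cut \<open>K\<close> into the cells indexed by the words \<open>w\<close> of a large
  length \<open>m\<close>, choose \<open>\<mu>\<^sub>w\<close> in each cell, and take \<open>u + \<Sum>\<^sub>w S\<^sub>\<mu>\<^sub>w\<^bsup>t(w)\<^esup> v\<close>, where the time \<open>t(w)\<close>
  serves the cell of \<open>w\<close>. By (b) all times may be of order \<open>s\<^sub>0\<^bsup>-m\<^esup>\<close> with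
  \<open>s\<^sub>0 = r\<^bsup>-1/(\<alpha>\<gamma>)\<^esup> < 1/r\<close>. They are placed along a self-similar Cantor set of ratio \<open>s\<close> with
  \<open>s\<^sub>0 < s < 1/r\<close>: cells sharing a prefix of length \<open>l\<close> are at distance \<open>O(s\<^sub>0\<^bsup>\<alpha>l\<^esup>)\<close> from each
  other, while their times are separated by a proportion at least \<open>c s\<^bsup>l\<^esup>\<close> of their size, so that (a)
  applies to every pair of cells, provided that \<open>K\<close> is small enough to absorb the constants. The
  resulting error sums tend to \<open>0\<close> because \<open>r s\<^sub>0\<^bsup>\<beta>\<^esup> < 1\<close> and \<open>s\<^sub>0 < s\<close>.
\<close>

section \<open>Words and the Cantor set coded by them\<close>

lemma index_words_0: "index_words r 0 = {[]}"
  by (auto simp: index_words_def)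

lemma index_words_Suc:
  "index_words r (Suc m) = (\<lambda>(a, w). a # w) ` ({1..r} \<times> index_words r m)"
  by (force simp: index_words_def length_Suc_conv)

lemma finite_index_words [simp]: "finite (index_words r m)"
  by (induction m) (auto simp: index_words_0 index_words_Suc)

lemma card_index_words: "card (index_words r m) = r ^ m"
  by (induction m)
    (auto simp: index_words_0 index_words_Suc card_image inj_on_def card_cartesian_product)

lemma index_words_append:
  "u @ v \<in> index_words r m \<longleftrightarrow>
     length u + length v = m \<and> u \<in> index_words r (length u) \<and> v \<in> index_words r (length v)"
  by (auto simp: index_words_def)

text \<open>The coding map of a Cantor set in \<open>[0, 1]\<close>, with \<open>r\<close> pieces of ratio \<open>s\<close> at each step.\<close>

primrec position :: "nat \<Rightarrow> real \<Rightarrow> nat list \<Rightarrow> real" where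
  "position r s [] = 0"
| "position r s (k # w) = (real k - 1) / real r + s * position r s w"

text \<open>The leading digit contributes at most \<open>1 - 1 / real r\<close> and the tail at most
  \<open>s\<close>, so the condition on \<open>s\<close> keeps the \<open>r\<close> pieces inside
  the unit interval.\<close>

lemma position_bounds:
  assumes "w \<in> index_words r m" "1 \<le> r" "0 \<le> s" "s \<le> 1 / real r"
  shows "0 \<le> position r s w \<and> position r s w \<le> 1"
  using assms(1)
proof (induction m arbitrary: w)
  case 0
  then show ?case by (simp add: index_words_0)
next
  case (Suc m)
  then obtain k v where w: "w = k # v" "1 \<le> k" "k \<le> r" "v \<in> index_words r m"
    by (auto simp: index_words_Suc)
  have v: "0 \<le> position r s v" "position r s v \<le> 1" using Suc.IH w by auto
  have "s * position r s v \<le> s" using v assms by (simp add: mult_left_le)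
  moreover have "(real k - 1) / real r \<le> (real r - 1) / real r"
    using w by (intro divide_right_mono) auto
  moreover have "(real r - 1) / real r = 1 - 1 / real r"
    using assms by (simp add: field_simps)
  ultimately show ?case using w v assms by auto
qed

text \<open>The leading digits differ by at least \<open>1 / real r\<close>, and the tails, scaled
  into an interval of length \<open>s\<close>, can undo at most \<open>s\<close> of this.\<close>

lemma position_separated_head:
  assumes "v \<in> index_words r m" "w \<in> index_words r m" "1 \<le> r" "0 \<le> s" "s \<le> 1 / real r"
    and "a \<noteq> b"
  shows "1 / real r - s \<le> \<bar>position r s (a # v) - position r s (b # w)\<bar>"
proof -
  have "\<bar>position r s v - position r s w\<bar> \<le> 1"
    using position_bounds[of v r m s] position_bounds[of w r m s] assms by auto
  then have *: "\<bar>s * (position r s v - position r s w)\<bar> \<le> s"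
    using assms by (simp add: abs_mult mult_left_le)
  have "1 / real r \<le> \<bar>real a - real b\<bar> / real r"
    using assms by (intro divide_right_mono) auto
  also have "\<dots> = \<bar>(real a - 1) / real r - (real b - 1) / real r\<bar>"
    by (simp add: diff_divide_distrib [symmetric])
  finally show ?thesis using * by (simp add: algebra_simps)
qed

text \<open>The \<open>p\<close> constructed is the longest common prefix: each shared letter
  multiplies the distance by \<open>s\<close>, and the first letters that differ leave a distance of
  at least \<open>1 / real r - s\<close>.\<close>

lemma position_separated:
  assumes "v \<in> index_words r m" "w \<in> index_words r m" "v \<noteq> w"
    and r: "1 \<le> r" "0 \<le> s" "s \<le> 1 / real r"
  shows "\<exists>p v' w'. v = p @ v' \<and> w = p @ w' \<and>
           (1 / real r - s) * s ^ length p \<le> \<bar>position r s v - position r s w\<bar>"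
  using assms(1-3)
proof (induction m arbitrary: v w)
  case 0
  then show ?case by (simp add: index_words_0)
next
  case (Suc m)
  then obtain a x b y where vw: "v = a # x" "w = b # y" "x \<in> index_words r m" "y \<in> index_words r m"
    by (auto simp: index_words_Suc)
  show ?case
  proof (cases "a = b")
    case False
    then show ?thesis
      using position_separated_head[OF vw(3,4) r False] vw
      by (intro exI[of _ "[]"] exI[of _ v] exI[of _ w]) simp
  next
    case True
    with Suc.prems vw have "x \<noteq> y" by auto
    from Suc.IH[OF vw(3,4) this] obtain p v' w' where p: "x = p @ v'" "y = p @ w'"
      "(1 / real r - s) * s ^ length p \<le> \<bar>position r s x - position r s y\<bar>" by blast
    have "(1 / real r - s) * s ^ length (a # p) = s * ((1 / real r - s) * s ^ length p)"
      by simp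
    also have "\<dots> \<le> s * \<bar>position r s x - position r s y\<bar>"
      using p r by (intro mult_left_mono) auto
    also have "\<dots> = \<bar>position r s v - position r s w\<bar>"
      using vw True r by (simp add: right_diff_distrib [symmetric] abs_mult)
    finally have "(1 / real r - s) * s ^ length (a # p) \<le> \<bar>position r s v - position r s w\<bar>" .
    then show ?thesis
      using p vw True by (intro exI[of _ "a # p"] exI[of _ v'] exI[of _ w']) simp
  qed
qed

text \<open>Self-similarity gives a recursion in \<open>m\<close>. Words with another first letter
  are at most \<open>r ^ Suc m\<close> in number and uniformly far from \<open>v\<close>; words with
  the same first letter form a copy scaled by \<open>s\<close>, which costs a factor
  \<open>s powr (- b)\<close>. As \<open>M\<close> dominates both growth rates, each level adds at
  most one more multiple of \<open>M ^ Suc m\<close>, whence the factor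
  \<open>real m\<close>.\<close>

lemma sum_inverse_distance_positions:
  assumes r: "1 \<le> r" "0 < s" "s < 1 / real r" and b: "0 < b"
    and M: "real r \<le> M" "s powr (- b) \<le> M"
    and v: "v \<in> index_words r m"
  shows "(\<Sum>w \<in> index_words r m - {v}. \<bar>position r s v - position r s w\<bar> powr (- b))
           \<le> (1 / real r - s) powr (- b) * (real m * M ^ m)"
  using v
proof (induction m arbitrary: v)
  case 0
  then show ?case by (simp add: index_words_0)
next
  case (Suc m)
  then obtain a x where v: "v = a # x" "a \<in> {1..r}" "x \<in> index_words r m"
    by (auto simp: index_words_Suc)
  define c where "c = 1 / real r - s"
  have c: "0 < c" using r by (simp add: c_def)
  have M0: "0 \<le> M" using r M by linarith
  define f where "f w = \<bar>position r s v - position r s w\<bar> powr (- b)" for w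
  define A where "A = (\<lambda>(k, w). k # w) ` (({1..r} - {a}) \<times> index_words r m)"
  define B where "B = Cons a ` (index_words r m - {x})"
  have "index_words r (Suc m) - {v} = A \<union> B"
    using v by (auto simp: index_words_Suc A_def B_def)
  moreover have "A \<inter> B = {}" "finite A" "finite B"
    by (auto simp: A_def B_def)
  ultimately have "sum f (index_words r (Suc m) - {v}) = sum f A + sum f B"
    by (simp add: sum.union_disjoint)
  also have "sum f A \<le> c powr (- b) * M ^ Suc m"
  proof -
    have "sum f A \<le> (\<Sum>w\<in>A. c powr (- b))"
    proof (rule sum_mono)
      fix w assume "w \<in> A"
      then obtain k y where w: "w = k # y" "k \<noteq> a" "y \<in> index_words r m"
        by (auto simp: A_def)
      have "c \<le> \<bar>position r s v - position r s w\<bar>"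
        unfolding c_def v(1) w(1)
        by (rule position_separated_head[of _ r m]) (use v w r in auto)
      then show "f w \<le> c powr (- b)"
        unfolding f_def using c b by (intro powr_mono2') auto
    qed
    also have "\<dots> = real (card A) * c powr (- b)" by simp
    also have "card A \<le> card (index_words r (Suc m))"
      by (rule card_mono) (auto simp: A_def index_words_Suc)
    also have "card (index_words r (Suc m)) = r ^ Suc m" by (rule card_index_words)
    also have "real (r ^ Suc m) \<le> M ^ Suc m"
      unfolding of_nat_power using M by (intro power_mono) auto
    finally show ?thesis by (simp add: mult_right_mono mult.commute)
  qed
  also have "sum f B \<le> c powr (- b) * (real m * M ^ Suc m)"
  proof -
    have "sum f B = (\<Sum>w\<in>index_words r m - {x}. f (a # w))"
      unfolding B_def by (subst sum.reindex) (auto simp: inj_on_def)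
    also have "\<dots> = s powr (- b) *
        (\<Sum>w\<in>index_words r m - {x}. \<bar>position r s x - position r s w\<bar> powr (- b))"
      unfolding sum_distrib_left f_def v(1) using r
      by (intro sum.cong) (auto simp: right_diff_distrib [symmetric] abs_mult powr_mult)
    also have "\<dots> \<le> M * (c powr (- b) * (real m * M ^ m))"
      using Suc.IH[OF v(3)] M M0 by (intro mult_mono sum_nonneg) (auto simp: c_def)
    finally show ?thesis by (simp add: algebra_simps)
  qed
  finally show ?case
    by (simp add: f_def c_def algebra_simps)
qed

section \<open>Choice of the times\<close>

text \<open>The times are the positions of the words, transported to the interval from
  \<open>h\<close> to \<open>2 * h\<close> and rounded down, with \<open>h\<close> proportional to
  \<open>1 / s0 ^ m\<close>. All times then have the same order of magnitude, so distances between
  positions become relative distances between times. Only the depth \<open>m\<close> remains to be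
  chosen.\<close>

lemma sparse_schedule:
  fixes r N :: nat and s0 s b \<kappa> \<epsilon> :: real
  assumes r: "1 \<le> r" and s0: "0 < s0" "s0 < s" and s: "s < 1 / real r"
    and b: "0 < b" "real r * s0 powr b < 1" and pos: "0 < \<kappa>" "0 < \<epsilon>"
  obtains m and t :: "nat list \<Rightarrow> nat" where
    "\<And>w. w \<in> index_words r m \<Longrightarrow> N < t w"
    "\<And>w. w \<in> index_words r m \<Longrightarrow> real (t w) * s0 ^ m \<le> \<kappa>"
    "\<And>v w. v \<in> index_words r m \<Longrightarrow> w \<in> index_words r m \<Longrightarrow> v \<noteq> w \<Longrightarrow>
       real N \<le> \<bar>real (t v) - real (t w)\<bar>"
    "\<And>v w. v \<in> index_words r m \<Longrightarrow> w \<in> index_words r m \<Longrightarrow> v \<noteq> w \<Longrightarrow>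
       \<exists>p v' w'. v = p @ v' \<and> w = p @ w' \<and>
         (1 / real r - s) / 4 * s ^ length p * real (max (t v) (t w)) \<le> \<bar>real (t v) - real (t w)\<bar>"
    "\<And>v. v \<in> index_words r m \<Longrightarrow>
       (\<Sum>w \<in> index_words r m - {v}. \<bar>real (t v) - real (t w)\<bar> powr (- b)) < \<epsilon>"
    "(\<Sum>w \<in> index_words r m. real (t w) powr (- b)) < \<epsilon>"
proof -
  define c where "c = 1 / real r - s"
  have inv_r: "1 / real r \<le> 1" using r by simp
  have c: "0 < c" "c \<le> 1" using s s0 inv_r by (auto simp: c_def)
  define M where "M = max (real r) (s powr (- b))"
  have M: "real r \<le> M" "s powr (- b) \<le> M" "0 < M"
    using r by (auto simp: M_def)
  \<comment> \<open>Growth rate of the error sums: \<open>s0 powr b\<close> comes from the size of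
    the times and \<open>M\<close> from summing over positions. It is below 1 for either value of
    the maximum \<open>M\<close>, by \<open>real r * s0 powr b < 1\<close> or by
    \<open>s0 < s\<close>.\<close>
  define \<rho> where "\<rho> = s0 powr b * M"
  have "s0 powr b * s powr (- b) < s powr b * s powr (- b)"
    using s0 b by (intro mult_strict_right_mono powr_less_mono2) auto
  also have "\<dots> = 1" using s0 by (simp add: powr_minus)
  finally have \<rho>: "0 < \<rho>" "\<rho> < 1"
    using b s0 M by (auto simp: \<rho>_def M_def max_def mult.commute)
  define K where "K = (\<kappa> / 4) powr (- b) * c powr (- b)"
  have "(\<lambda>m. K * (real m * \<rho> ^ m)) \<longlonglongrightarrow> 0"
    using \<rho> tendsto_mult_right_zero[OF powser_times_n_limit_0[of \<rho>]] by simp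
  then have "\<forall>\<^sub>F m in sequentially. K * (real m * \<rho> ^ m) < \<epsilon>"
    by (rule order_tendstoD(2)) (use pos in simp)
  moreover have "(\<lambda>m. (s0 / s) ^ m) \<longlonglongrightarrow> 0"
    using s0 by (intro LIMSEQ_power_zero) auto
  then have "\<forall>\<^sub>F m in sequentially. (s0 / s) ^ m < \<kappa> * c / (4 * (real N + 1))"
    by (rule order_tendstoD(2)) (use pos c in auto)
  ultimately have "\<forall>\<^sub>F m in sequentially. K * (real m * \<rho> ^ m) < \<epsilon> \<and>
      (s0 / s) ^ m < \<kappa> * c / (4 * (real N + 1)) \<and> 1 \<le> m"
    using eventually_ge_at_top[of 1] by eventually_elim auto
  \<comment> \<open>The first condition controls both error sums. The second makes the times large
    and keeps them apart. The third allows the total sum to be bounded by the same quantity as the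
    sums over differences.\<close>
  then obtain m where m: "K * (real m * \<rho> ^ m) < \<epsilon>"
      "(s0 / s) ^ m < \<kappa> * c / (4 * (real N + 1))" "1 \<le> m"
    by (auto simp: eventually_sequentially)
  \<comment> \<open>The factor 2 is there because the times reach up to
    \<open>2 * h\<close>.\<close>
  define h where "h = \<kappa> / (2 * s0 ^ m)"
  have h: "0 < h" using pos s0 by (simp add: h_def)
  \<comment> \<open>Even the smallest possible distance \<open>c * s ^ m\<close> between positions
    gives a time gap with room for \<open>N\<close> and for rounding.\<close>
  have gap: "2 * (real N + 1) \<le> h * c * s ^ m"
    using m(2) s0 by (simp add: h_def field_simps power_divide)
  have s1: "s < 1" using s inv_r by linarith
  have "c * s ^ m \<le> 1"
    using c s0 s1 by (intro mult_le_one power_le_one) auto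
  then have "h * (c * s ^ m) \<le> h * 1" using h by (intro mult_left_mono) auto
  then have h_large: "2 * (real N + 1) \<le> h" using gap by (simp add: mult.assoc)
  have h_powr: "(h / 2) powr (- b) = (\<kappa> / 4) powr (- b) * (s0 powr b) ^ m"
  proof -
    have h2: "h / 2 = (\<kappa> / 4) * (s0 powr (- real m))"
      using s0 by (simp add: h_def powr_minus_divide powr_realpow)
    have "(h / 2) powr (- b) = (\<kappa> / 4) powr (- b) * (s0 powr (- real m)) powr (- b)"
      unfolding h2 by (rule powr_mult)
    also have "(s0 powr (- real m)) powr (- b) = (s0 powr b) powr real m"
      by (simp add: powr_powr mult.commute)
    also have "\<dots> = (s0 powr b) ^ m"
      using s0 by (simp add: powr_realpow)
    finally show ?thesis .
  qed
  define x where "x = position r s"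
  define t where "t w = nat \<lfloor>h * (1 + x w)\<rfloor>" for w
  have x: "0 \<le> x w" "x w \<le> 1" if "w \<in> index_words r m" for w
    using position_bounds[OF that r, of s] s s0 by (auto simp: x_def)
  have t: "real (t w) \<le> h * (1 + x w)" "h * (1 + x w) < real (t w) + 1"
    if "w \<in> index_words r m" for w
  proof -
    have "0 \<le> h * (1 + x w)" using h x[OF that] by simp
    then show "real (t w) \<le> h * (1 + x w)" "h * (1 + x w) < real (t w) + 1"
      unfolding t_def by linarith+
  qed
  have t_le: "real (t w) \<le> 2 * h" if "w \<in> index_words r m" for w
  proof -
    have "h * (1 + x w) \<le> h * 2" using x(2)[OF that] h by (intro mult_left_mono) auto
    with t(1)[OF that] show ?thesis by linarith
  qed
  have t_ge: "h / 2 \<le> real (t w)" "N < t w" if "w \<in> index_words r m" for w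
  proof -
    have "h < real (t w) + 1"
      using t(2)[OF that] mult_nonneg_nonneg[OF less_imp_le[OF h] x(1)[OF that]]
      by (simp add: algebra_simps)
    with h_large show "h / 2 \<le> real (t w)" and "N < t w" by simp_all
  qed
  have prefix: "\<exists>p v' w'. v = p @ v' \<and> w = p @ w' \<and> length p \<le> m \<and> c * s ^ length p \<le> \<bar>x v - x w\<bar>"
    if vw: "v \<in> index_words r m" "w \<in> index_words r m" "v \<noteq> w" for v w
  proof -
    obtain p v' w' where p: "v = p @ v'" "w = p @ w'" "c * s ^ length p \<le> \<bar>x v - x w\<bar>"
      using position_separated[OF vw r, of s] s s0 by (auto simp: c_def x_def)
    moreover have "length p \<le> m" using p(1) vw(1) by (auto simp: index_words_def)
    ultimately show ?thesis by blast
  qed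
  \<comment> \<open>Rounding changes a difference of times by at most 1. Since \<open>gap\<close>
    gives \<open>real N + 1\<close> as a lower bound for half of
    \<open>h * \<bar>x v - x w\<bar>\<close>, this half pays for \<open>N\<close> and the rounding,
    and the other half remains.\<close>
  have t_gap: "h * \<bar>x v - x w\<bar> / 2 + real N \<le> \<bar>real (t v) - real (t w)\<bar>"
    if vw: "v \<in> index_words r m" "w \<in> index_words r m" "v \<noteq> w" for v w
  proof -
    obtain p :: "nat list" where p: "length p \<le> m" "c * s ^ length p \<le> \<bar>x v - x w\<bar>"
      using prefix[OF vw] by blast
    have "c * s ^ m \<le> c * s ^ length p"
      using p s0 s1 c by (intro mult_left_mono power_decreasing) auto
    with p(2) have "h * (c * s ^ m) \<le> h * \<bar>x v - x w\<bar>"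
      using h by (intro mult_left_mono) auto
    with gap have "2 * (real N + 1) \<le> h * \<bar>x v - x w\<bar>" by (simp add: mult.assoc)
    moreover have "h * \<bar>x v - x w\<bar> = \<bar>h * (1 + x v) - h * (1 + x w)\<bar>"
      using h by (simp add: right_diff_distrib [symmetric] abs_mult del: distrib_left)
    moreover have "\<bar>A - B\<bar> \<le> \<bar>a - b\<bar> + 1"
      if "a \<le> A" "A < a + 1" "b \<le> B" "B < b + 1" for a b A B :: real
      using that by (simp add: abs_le_iff) linarith
    note this[OF t[OF vw(1)] t[OF vw(2)]]
    ultimately show ?thesis by simp
  qed
  show ?thesis
  proof (rule that[of m t])
    show "N < t w" if "w \<in> index_words r m" for w
      using t_ge(2)[OF that] .
    show "real (t w) * s0 ^ m \<le> \<kappa>" if "w \<in> index_words r m" for w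
      using t_le[OF that] s0 by (simp add: h_def field_simps)
    show "real N \<le> \<bar>real (t v) - real (t w)\<bar>"
      if "v \<in> index_words r m" "w \<in> index_words r m" "v \<noteq> w" for v w
      using t_gap[OF that] h by (smt (verit) divide_nonneg_nonneg mult_nonneg_nonneg)
    show "\<exists>p v' w'. v = p @ v' \<and> w = p @ w' \<and>
        (1 / real r - s) / 4 * s ^ length p * real (max (t v) (t w)) \<le> \<bar>real (t v) - real (t w)\<bar>"
      if vw: "v \<in> index_words r m" "w \<in> index_words r m" "v \<noteq> w" for v w
    proof -
      obtain p v' w' where p: "v = p @ v'" "w = p @ w'" "c * s ^ length p \<le> \<bar>x v - x w\<bar>"
        using prefix[OF vw] by blast
      \<comment> \<open>The divisor 4 combines the bound \<open>2 * h\<close> on the times with the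
        half lost in \<open>t_gap\<close>.\<close>
      have "c / 4 * s ^ length p * real (max (t v) (t w)) \<le> c / 4 * s ^ length p * (2 * h)"
        using t_le[OF vw(1)] t_le[OF vw(2)] c s0 by (intro mult_left_mono) auto
      also have "\<dots> = h * (c * s ^ length p) / 2" by simp
      also have "\<dots> \<le> h * \<bar>x v - x w\<bar> / 2"
        using p(3) h by (intro divide_right_mono mult_left_mono) auto
      also have "\<dots> \<le> \<bar>real (t v) - real (t w)\<bar>"
        using t_gap[OF vw] by linarith
      finally show ?thesis using p unfolding c_def by blast
    qed
    show "(\<Sum>w \<in> index_words r m - {v}. \<bar>real (t v) - real (t w)\<bar> powr (- b)) < \<epsilon>"
      if v: "v \<in> index_words r m" for v
    proof -
      have "(\<Sum>w \<in> index_words r m - {v}. \<bar>real (t v) - real (t w)\<bar> powr (- b))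
          \<le> (\<Sum>w \<in> index_words r m - {v}. (h / 2) powr (- b) * \<bar>x v - x w\<bar> powr (- b))"
      proof (rule sum_mono)
        fix w assume w: "w \<in> index_words r m - {v}"
        then obtain p :: "nat list" where "c * s ^ length p \<le> \<bar>x v - x w\<bar>"
          using prefix[OF v, of w] by blast
        then have "0 < \<bar>x v - x w\<bar>" using c s0 by (smt (verit) mult_pos_pos zero_less_power)
        then have "0 < h / 2 * \<bar>x v - x w\<bar>" using h by simp
        moreover have "h / 2 * \<bar>x v - x w\<bar> \<le> \<bar>real (t v) - real (t w)\<bar>"
          using t_gap[OF v, of w] w by auto
        ultimately have "\<bar>real (t v) - real (t w)\<bar> powr (- b) \<le> (h / 2 * \<bar>x v - x w\<bar>) powr (- b)"
          using b by (intro powr_mono2') auto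
        then show "\<bar>real (t v) - real (t w)\<bar> powr (- b) \<le> (h / 2) powr (- b) * \<bar>x v - x w\<bar> powr (- b)"
          using h by (subst (asm) powr_mult) auto
      qed
      also have "\<dots> \<le> (h / 2) powr (- b) * (c powr (- b) * (real m * M ^ m))"
        unfolding sum_distrib_left [symmetric] c_def x_def
        using sum_inverse_distance_positions[OF r _ s b(1) M(1,2) v] s0
        by (intro mult_left_mono) auto
      also have "\<dots> = K * (real m * \<rho> ^ m)"
        by (simp add: h_powr K_def \<rho>_def power_mult_distrib)
      finally show ?thesis using m(1) by linarith
    qed
    have "(\<Sum>w \<in> index_words r m. real (t w) powr (- b)) \<le> (\<Sum>w \<in> index_words r m. (h / 2) powr (- b))"
      using t_ge h b by (intro sum_mono powr_mono2') auto
    also have "\<dots> = (h / 2) powr (- b) * real r ^ m"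
      by (simp add: card_index_words)
    \<comment> \<open>A deliberately crude bound, so that the choice of \<open>m\<close> for the
      previous sum serves here as well.\<close>
    also have "\<dots> \<le> (h / 2) powr (- b) * (c powr (- b) * (real m * M ^ m))"
    proof (rule mult_left_mono)
      have "1 powr (- b) \<le> c powr (- b)" using c b by (intro powr_mono2') auto
      moreover have "1 \<le> real m" using m by simp
      ultimately have "1 * (1 * real r ^ m) \<le> c powr (- b) * (real m * M ^ m)"
        using M by (intro mult_mono power_mono) auto
      then show "real r ^ m \<le> c powr (- b) * (real m * M ^ m)" by simp
    qed simp
    also have "\<dots> = K * (real m * \<rho> ^ m)"
      by (simp add: h_powr K_def \<rho>_def power_mult_distrib)
    finally show "(\<Sum>w \<in> index_words r m. real (t w) powr (- b)) < \<epsilon>" using m(1) by linarith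
  qed
qed

section \<open>Baire category argument\<close>

text \<open>The pairs for which some \<open>n\<close> works form a relatively open set. If it
  contains the slice over \<open>x\<close>, compactness of \<open>K\<close> and the tube lemma give
  a neighbourhood of \<open>x\<close> whose slices it also contains; \<open>n\<close> may vary with
  \<open>l\<close>.\<close>

lemma open_uniformly_hitting:
  fixes f :: "nat \<Rightarrow> 'b::topological_space \<Rightarrow> 'a::topological_space \<Rightarrow> real"
  assumes "compact K" and cont: "\<And>n. continuous_on (K \<times> UNIV) (\<lambda>(l, x). f n l x)"
  shows "open {x. \<forall>l\<in>K. \<exists>n. f n l x < e}"
proof (subst open_subopen, safe)
  fix x assume x: "\<forall>l\<in>K. \<exists>n. f n l x < e"
  let ?A = "\<lambda>n. (UNIV \<times> K) \<inter> (\<lambda>(x, l). f n l x) -` {..<e}"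
  have "continuous_on (UNIV \<times> K) (\<lambda>(x, l). f n l x)" for n
    using continuous_on_compose2[OF cont[of n], of "UNIV \<times> K" prod.swap]
    by (simp add: continuous_on_swap case_prod_unfold product_swap)
  then have "openin (top_of_set (UNIV \<times> K)) (\<Union>n. ?A n)"
    by (intro openin_Union) (auto intro: continuous_openin_preimage_gen)
  then obtain W where W: "open W" "(\<Union>n. ?A n) = (UNIV \<times> K) \<inter> W"
    by (auto simp: openin_open)
  have "{x} \<times> K \<subseteq> (\<Union>n. ?A n)" using x by auto
  then have "{x} \<times> K \<subseteq> W" using W(2) by blast
  then obtain X where X: "x \<in> X" "open X" "X \<times> K \<subseteq> W"
    using Elementary_Topology.tube_lemma[OF \<open>compact K\<close> W(1)] by blast
  have "X \<times> K \<subseteq> (\<Union>n. ?A n)" using X(3) W(2) by blast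
  then have "X \<subseteq> {x. \<forall>l\<in>K. \<exists>n. f n l x < e}" by fastforce
  with X show "\<exists>X. open X \<and> x \<in> X \<and> X \<subseteq> {x. \<forall>l\<in>K. \<exists>n. f n l x < e}" by blast
qed

lemma continuous_on_funpow_family:
  fixes T :: "'b::topological_space \<Rightarrow> 'a::topological_space \<Rightarrow> 'a"
  assumes "continuous_on (A \<times> UNIV) (\<lambda>(l, u). T l u)"
  shows "continuous_on (A \<times> UNIV) (\<lambda>(l, u). (T l ^^ n) u)"
proof (induction n)
  case 0
  then show ?case by (simp add: case_prod_unfold continuous_on_snd)
next
  case (Suc n)
  have "continuous_on (A \<times> UNIV) (\<lambda>p. (fst p, (T (fst p) ^^ n) (snd p)))"
    using Suc.IH by (intro continuous_on_Pair continuous_on_fst) (auto simp: case_prod_unfold)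
  from continuous_on_compose2[OF assms this] have
    "continuous_on (A \<times> UNIV) (\<lambda>p. T (fst p) ((T (fst p) ^^ n) (snd p)))"
    by (simp add: case_prod_unfold image_subset_iff)
  then show ?case by (simp add: case_prod_unfold)
qed

lemma dense_gdelta_countable_Inter:
  fixes \<G> :: "'a::complete_space set set"
  assumes "countable \<G>" and "\<And>G. G \<in> \<G> \<Longrightarrow> open G" and "\<And>G. G \<in> \<G> \<Longrightarrow> closure G = UNIV"
  shows "gdelta (\<Inter>\<G>) \<and> closure (\<Inter>\<G>) = UNIV"
proof
  \<comment> \<open>Inserting \<open>UNIV\<close> makes the family nonempty, so that a sequence
    enumerates it, and leaves the intersection unchanged.\<close>
  obtain U :: "nat \<Rightarrow> 'a set" where U: "range U = insert UNIV \<G>"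
    using assms(1) uncountable_def[of "insert UNIV \<G>"] by auto
  then have "open (U n)" for n
    using assms(2) by (metis insertE open_UNIV rangeI)
  then have "gdelta (\<Inter>(range U))" by (rule gdelta.intros)
  then show "gdelta (\<Inter>\<G>)" by (simp add: U)
  show "closure (\<Inter>\<G>) = UNIV"
    using Met_TC.metric_Baire_category[where ?'a = 'a, of \<G>] assms complete_UNIV by simp
qed

text \<open>With \<open>Q\<close> countable, this writes the hypercyclic vectors as an intersection
  of countably many conditions, as Baire's theorem requires.\<close>

lemma hypercyclic_vectors_iff:
  fixes T :: "'a::real_normed_vector \<Rightarrow> 'a"
  assumes Q: "closure Q = UNIV"
  shows "x \<in> hypercyclic_vectors T \<longleftrightarrow> (\<forall>v\<in>Q. \<forall>k. \<exists>n. norm ((T ^^ n) x - v) < 1 / real (Suc k))"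
proof -
  define R where "R = range (\<lambda>n. (T ^^ n) x)"
  have "v \<in> closure R \<longleftrightarrow> (\<forall>k. \<exists>n. norm ((T ^^ n) x - v) < 1 / real (Suc k))" for v
  proof
    assume "v \<in> closure R"
    then have "\<exists>n. norm ((T ^^ n) x - v) < e" if "0 < e" for e
      using that unfolding closure_approachable R_def dist_norm by blast
    then show "\<forall>k. \<exists>n. norm ((T ^^ n) x - v) < 1 / real (Suc k)"
      by (simp del: of_nat_Suc)
  next
    assume *: "\<forall>k. \<exists>n. norm ((T ^^ n) x - v) < 1 / real (Suc k)"
    show "v \<in> closure R"
      unfolding closure_approachable
    proof safe
      fix e :: real assume "0 < e"
      then obtain k where "1 / real (Suc k) < e" by (rule nat_approx_posE)
      moreover obtain n where "norm ((T ^^ n) x - v) < 1 / real (Suc k)" using * by metis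
      ultimately have "dist ((T ^^ n) x) v < e" by (simp add: dist_norm)
      then show "\<exists>y\<in>R. dist y v < e" unfolding R_def by blast
    qed
  qed
  moreover have "closure R = UNIV \<longleftrightarrow> Q \<subseteq> closure R"
    using closure_minimal[of Q "closure R"] Q by (metis closed_closure subset_UNIV top.extremum_uniqueI)
  ultimately show ?thesis
    unfolding hypercyclic_vectors_def R_def[symmetric] mem_Collect_eq subset_iff Ball_def by metis
qed

text \<open>The set in question is a countable intersection indexed by a piece, a target from a
  countable dense set and a tolerance. Compactness of the pieces makes each member open, and
  \<open>approx\<close> makes it dense.\<close>

lemma common_hypercyclicity_criterion:
  fixes T :: "'b::topological_space \<Rightarrow> 'a::banach \<Rightarrow> 'a"
  assumes separable: "separable_space (euclidean :: 'a topology)"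
    and cont: "continuous_on (\<Union>\<K> \<times> UNIV) (\<lambda>(l, u). T l u)"
    and countable: "countable \<K>" and compact: "\<And>K. K \<in> \<K> \<Longrightarrow> compact K"
    and dense: "closure \<D> = UNIV"
    and approx: "\<And>K u v \<epsilon>. K \<in> \<K> \<Longrightarrow> u \<in> \<D> \<Longrightarrow> v \<in> \<D> \<Longrightarrow> 0 < \<epsilon> \<Longrightarrow>
      \<exists>y. norm (y - u) < \<epsilon> \<and> (\<forall>l\<in>K. \<exists>n. norm ((T l ^^ n) y - v) < \<epsilon>)"
  shows "gdelta (\<Inter>l\<in>\<Union>\<K>. hypercyclic_vectors (T l)) \<and>
         closure (\<Inter>l\<in>\<Union>\<K>. hypercyclic_vectors (T l)) = UNIV"
proof -
  obtain Q :: "'a set" where Q: "countable Q" "closure Q = UNIV"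
    using separable by (auto simp: separable_space_def)
  define G where "G = (\<lambda>(K, v, k::nat). {x. \<forall>l\<in>K. \<exists>n. norm ((T l ^^ n) x - v) < 1 / real (Suc k)})"
  define \<G> where "\<G> = G ` (\<K> \<times> Q \<times> UNIV)"
  have "(\<Inter>l\<in>\<Union>\<K>. hypercyclic_vectors (T l)) = \<Inter>\<G>"
    unfolding \<G>_def G_def by (auto simp: hypercyclic_vectors_iff[OF Q(2)])
  moreover have "gdelta (\<Inter>\<G>) \<and> closure (\<Inter>\<G>) = UNIV"
  proof (rule dense_gdelta_countable_Inter)
    show "countable \<G>" unfolding \<G>_def using countable Q(1) by auto
  next
    fix A assume "A \<in> \<G>"
    then obtain K v k where A: "K \<in> \<K>" "A = {x. \<forall>l\<in>K. \<exists>n. norm ((T l ^^ n) x - v) < 1 / real (Suc k)}"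
      by (auto simp: \<G>_def G_def)
    have "continuous_on (K \<times> UNIV) (\<lambda>(l, u). T l u)"
      by (rule continuous_on_subset[OF cont]) (use A in auto)
    from continuous_on_funpow_family[OF this]
    have "continuous_on (K \<times> UNIV) (\<lambda>(l, x). norm ((T l ^^ n) x - v))" for n
      unfolding case_prod_unfold by (intro continuous_on_norm continuous_on_diff continuous_on_const)
    then show "open A"
      unfolding A(2) by (rule open_uniformly_hitting[OF compact[OF A(1)]])
    show "closure A = UNIV"
    proof -
      have "x \<in> closure A" for x
        unfolding closure_approachable
      proof safe
        fix e :: real assume e: "0 < e"
        \<comment> \<open>Both the centre \<open>x\<close> and the target \<open>v\<close> are first
          moved into \<open>\<D>\<close>, where \<open>approx\<close> applies. Each estimate then
          loses two errors of size \<open>\<epsilon>\<close>.\<close>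
        define \<epsilon> where "\<epsilon> = min (e / 2) (1 / (2 * real (Suc k)))"
        have \<epsilon>: "0 < \<epsilon>" "2 * \<epsilon> \<le> e" "2 * \<epsilon> \<le> 1 / real (Suc k)"
          using e by (auto simp: \<epsilon>_def min_def field_simps)
        obtain u where u: "u \<in> \<D>" "norm (u - x) < \<epsilon>"
          using \<epsilon>(1) dense closure_approachable[of x \<D>] by (auto simp: dist_norm)
        obtain v' where v': "v' \<in> \<D>" "norm (v' - v) < \<epsilon>"
          using \<epsilon>(1) dense closure_approachable[of v \<D>] by (auto simp: dist_norm)
        obtain y where y: "norm (y - u) < \<epsilon>" "\<forall>l\<in>K. \<exists>n. norm ((T l ^^ n) y - v') < \<epsilon>"
          using approx[OF A(1) u(1) v'(1) \<epsilon>(1)] by blast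
        have "y \<in> A"
          unfolding A(2)
        proof safe
          fix l assume "l \<in> K"
          then obtain n where "norm ((T l ^^ n) y - v') < \<epsilon>" using y by blast
          then have "norm ((T l ^^ n) y - v) < \<epsilon> + \<epsilon>"
            using v'(2) norm_triangle_lt[of "(T l ^^ n) y - v'" "v' - v" "\<epsilon> + \<epsilon>"] by simp
          then show "\<exists>n. norm ((T l ^^ n) y - v) < 1 / real (Suc k)"
            using \<epsilon>(3) by (intro exI[of _ n]) linarith
        qed
        moreover have "norm (y - x) < \<epsilon> + \<epsilon>"
          using y(1) u(2) norm_triangle_lt[of "y - u" "u - x" "\<epsilon> + \<epsilon>"] by simp
        ultimately show "\<exists>y\<in>A. dist y x < e"
          using \<epsilon>(2) by (intro bexI[of _ y]) (auto simp: dist_norm)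
      qed
      then show ?thesis by blast
    qed
  qed
  ultimately show ?thesis by simp
qed

section \<open>Approximation on one small piece\<close>

lemma linear_funpow:
  fixes f :: "'a::real_vector \<Rightarrow> 'a"
  assumes "linear f"
  shows "linear (f ^^ n)"
proof (induction n)
  case 0
  then show ?case by (simp only: funpow.simps linear_id)
next
  case (Suc n)
  then show ?case using linear_compose[OF _ assms] by (simp only: funpow.simps)
qed

lemma power_powr_commute:
  fixes x :: real
  assumes "0 < x"
  shows "(x powr a) ^ n = (x ^ n) powr a"
  using assms by (induction n) (simp_all add: powr_mult)

text \<open>The depth \<open>m\<close> is fixed only inside the proof, depending on
  \<open>u\<close>, \<open>v\<close> and \<open>\<epsilon>\<close>, so \<open>K\<close> has to be
  covered at every depth. The upper bound on \<open>\<delta>\<close> is the constant for which the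
  closeness of two cells matches the separation of their times in
  \<open>sparse_schedule\<close>.\<close>

lemma approximation_on_small_piece:
  fixes T S :: "real ^ 'd \<Rightarrow> 'a::real_normed_vector \<Rightarrow> 'a"
    and L :: "nat list \<Rightarrow> (real ^ 'd) set"
  assumes cells: "\<And>m w. w \<in> index_words r m \<Longrightarrow> L w \<subseteq> \<Lambda>"
    and nest: "\<And>m p q. p @ q \<in> index_words r m \<Longrightarrow> L (p @ q) \<subseteq> L p"
    and cover: "\<And>m. K \<subseteq> (\<Union>w\<in>index_words r m. L w)"
    and diam: "\<And>m w x y. w \<in> index_words r m \<Longrightarrow> x \<in> L w \<Longrightarrow> y \<in> L w \<Longrightarrow>
      infnorm (x - y) \<le> \<delta> * (s0 powr \<alpha>) ^ m"
    and \<delta>: "0 < \<delta>" "\<delta> \<le> D * ((1 / real r - s) / 4) powr \<alpha>"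
    and r: "1 \<le> r" and s: "0 < s0" "s0 < s" "s < 1 / real r" "real r * s0 powr \<beta> < 1"
    and pos: "0 < \<alpha>" "0 < \<beta>" "0 < D" "0 < \<epsilon>"
    and bounded: "\<And>l. l \<in> \<Lambda> \<Longrightarrow> bounded_linear (T l)"
    and a: "\<And>z. z \<in> {u, v} \<Longrightarrow> \<exists>C>0. \<exists>N::nat. N > 0 \<and>
        (\<forall>l\<in>\<Lambda>. \<forall>\<mu>\<in>\<Lambda>. \<forall>n k :: nat. N \<le> k \<longrightarrow>
           infnorm (l - \<mu>) \<le> D * (real k powr \<alpha> / real (n + k) powr \<alpha>) \<longrightarrow>
           norm ((T l ^^ (n + k)) ((S \<mu> ^^ n) z)) \<le> C / real k powr \<beta> \<and>
           norm ((T l ^^ n) ((S \<mu> ^^ (n + k)) z)) \<le> C / real k powr \<beta>)"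
    and b: "\<And>e. 0 < e \<Longrightarrow> \<exists>\<tau>>0. \<forall>n::nat. 1 \<le> n \<longrightarrow>
        (\<forall>l\<in>\<Lambda>. \<forall>\<mu>\<in>\<Lambda>. infnorm (l - \<mu>) \<le> \<tau> / real n powr \<alpha> \<longrightarrow>
           norm ((T l ^^ n) ((S \<mu> ^^ n) v) - v) < e)"
  shows "\<exists>y. norm (y - u) < \<epsilon> \<and> (\<forall>l\<in>K. \<exists>n. norm ((T l ^^ n) y - v) < \<epsilon>)"
proof -
  obtain C1 N1 where C1: "0 < C1" and N1: "\<And>l \<mu> n k. l \<in> \<Lambda> \<Longrightarrow> \<mu> \<in> \<Lambda> \<Longrightarrow> N1 \<le> k \<Longrightarrow>
      infnorm (l - \<mu>) \<le> D * (real k powr \<alpha> / real (n + k) powr \<alpha>) \<Longrightarrow>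
      norm ((T l ^^ (n + k)) ((S \<mu> ^^ n) u)) \<le> C1 / real k powr \<beta>"
    using a[of u] by blast
  obtain C2 N2 where C2: "0 < C2" and N2: "\<And>l \<mu> n k. l \<in> \<Lambda> \<Longrightarrow> \<mu> \<in> \<Lambda> \<Longrightarrow> N2 \<le> k \<Longrightarrow>
      infnorm (l - \<mu>) \<le> D * (real k powr \<alpha> / real (n + k) powr \<alpha>) \<Longrightarrow>
      norm ((T l ^^ (n + k)) ((S \<mu> ^^ n) v)) \<le> C2 / real k powr \<beta> \<and>
      norm ((T l ^^ n) ((S \<mu> ^^ (n + k)) v)) \<le> C2 / real k powr \<beta>"
    using a[of v] by blast
  obtain \<tau> where \<tau>: "0 < \<tau>" and b\<tau>: "\<And>n l \<mu>. 1 \<le> n \<Longrightarrow> l \<in> \<Lambda> \<Longrightarrow> \<mu> \<in> \<Lambda> \<Longrightarrow>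
      infnorm (l - \<mu>) \<le> \<tau> / real n powr \<alpha> \<Longrightarrow> norm ((T l ^^ n) ((S \<mu> ^^ n) v) - v) < \<epsilon> / 3"
    using b[of "\<epsilon> / 3"] pos by auto
  have s_pos: "0 < s" using s by linarith
  define C where "C = max C1 C2"
  define N where "N = max N1 N2"
  \<comment> \<open>Each sum of decay factors, multiplied by the constant of (a), may use a third of
    \<open>\<epsilon>\<close>.\<close>
  define \<eta> where "\<eta> = \<epsilon> / (3 * C)"
  have C: "0 < C" "C1 \<le> C" "C2 \<le> C" using C1 by (auto simp: C_def)
  have \<eta>: "0 < \<eta>" "C * \<eta> = \<epsilon> / 3" using C(1) pos by (auto simp: \<eta>_def)
  \<comment> \<open>This bound on \<open>real (t w) * s0 ^ m\<close> is what turns the cell diameter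
    \<open>\<delta> * (s0 powr \<alpha>) ^ m\<close> into the closeness that (b) requires at time
    \<open>t w\<close>.\<close>
  have \<kappa>: "0 < (\<tau> / \<delta>) powr (1 / \<alpha>)" using \<tau> \<delta> by simp
  obtain m and t :: "nat list \<Rightarrow> nat" where
    t_large: "\<And>w. w \<in> index_words r m \<Longrightarrow> N < t w" and
    t_small: "\<And>w. w \<in> index_words r m \<Longrightarrow> real (t w) * s0 ^ m \<le> (\<tau> / \<delta>) powr (1 / \<alpha>)" and
    t_gap: "\<And>v w. v \<in> index_words r m \<Longrightarrow> w \<in> index_words r m \<Longrightarrow> v \<noteq> w \<Longrightarrow>
       real N \<le> \<bar>real (t v) - real (t w)\<bar>" and
    t_prefix: "\<And>v w. v \<in> index_words r m \<Longrightarrow> w \<in> index_words r m \<Longrightarrow> v \<noteq> w \<Longrightarrow>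
       \<exists>p v' w'. v = p @ v' \<and> w = p @ w' \<and>
         (1 / real r - s) / 4 * s ^ length p * real (max (t v) (t w)) \<le> \<bar>real (t v) - real (t w)\<bar>" and
    t_sum: "\<And>v. v \<in> index_words r m \<Longrightarrow>
       (\<Sum>w \<in> index_words r m - {v}. \<bar>real (t v) - real (t w)\<bar> powr (- \<beta>)) < \<eta>" and
    t_total: "(\<Sum>w \<in> index_words r m. real (t w) powr (- \<beta>)) < \<eta>"
  proof (rule sparse_schedule[OF r s(1,2,3) pos(2) s(4) \<kappa> \<eta>(1), where N = N], goal_cases)
    case (1 m t)
    show ?case by (rule 1(1)[OF 1(2-7)])
  qed
  \<comment> \<open>An empty cell offers no parameter to choose and contains no \<open>l\<close> to
    be served.\<close>
  define W where "W = {w \<in> index_words r m. L w \<noteq> {}}"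
  have W: "finite W" "W \<subseteq> index_words r m" by (auto simp: W_def)
  have "\<forall>w\<in>W. \<exists>x. x \<in> L w" by (auto simp: W_def)
  then obtain c where c: "\<And>w. w \<in> W \<Longrightarrow> c w \<in> L w" by metis
  have c\<Lambda>: "c w \<in> \<Lambda>" if "w \<in> W" for w
    using c[OF that] cells[of w m] W that by blast
  define g where "g w = (S (c w) ^^ t w) v" for w
  define y where "y = u + sum g W"

  \<comment> \<open>The second estimate of (a) with \<open>n = 0\<close> and equal
    parameters.\<close>
  have "norm (g w) \<le> C * real (t w) powr (- \<beta>)" if w: "w \<in> W" for w
  proof -
    have tw: "N < t w" using t_large w W by blast
    then have "norm ((T (c w) ^^ 0) ((S (c w) ^^ (0 + t w)) v)) \<le> C2 / real (t w) powr \<beta>"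
      using N2[OF c\<Lambda>[OF w] c\<Lambda>[OF w], of "t w" 0] pos by (auto simp: N_def infnorm_0)
    also have "\<dots> \<le> C / real (t w) powr \<beta>" using C by (intro divide_right_mono) auto
    finally show ?thesis by (simp add: g_def powr_minus_divide)
  qed
  then have "norm (sum g W) \<le> (\<Sum>w\<in>W. C * real (t w) powr (- \<beta>))"
    by (rule sum_norm_le)
  also have "\<dots> \<le> (\<Sum>w\<in>index_words r m. C * real (t w) powr (- \<beta>))"
    using W C by (intro sum_mono2) auto
  also have "\<dots> < \<epsilon>"
    using mult_strict_left_mono[OF t_total C(1)] \<eta> pos by (simp add: sum_distrib_left)
  finally have y_near: "norm (y - u) < \<epsilon>" by (simp add: y_def)

  have cross: "norm ((T l ^^ t i) (g j)) \<le> C * \<bar>real (t i) - real (t j)\<bar> powr (- \<beta>)"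
    if i: "i \<in> W" "l \<in> L i" and j: "j \<in> W" "j \<noteq> i" for i j l
  proof -
    have ij: "i \<in> index_words r m" "j \<in> index_words r m" "i \<noteq> j" using i j W by auto
    have l\<Lambda>: "l \<in> \<Lambda>" using i(2) cells[OF ij(1)] by blast
    obtain p i' j' where p: "i = p @ i'" "j = p @ j'"
      "(1 / real r - s) / 4 * s ^ length p * real (max (t i) (t j)) \<le> \<bar>real (t i) - real (t j)\<bar>"
      using t_prefix[OF ij] by blast
    define k where "k = nat \<bar>int (t i) - int (t j)\<bar>"
    \<comment> \<open>With \<open>n\<close> the smaller of the two times, \<open>M\<close> is the
      \<open>n + k\<close> of (a).\<close>
    define M where "M = max (t i) (t j)"
    have k: "real k = \<bar>real (t i) - real (t j)\<bar>" by (simp add: k_def)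
    have kN: "N \<le> k" using t_gap[OF ij] k by linarith
    have M: "0 < real M" using t_large[OF ij(1)] by (simp add: M_def)
    have pw: "p \<in> index_words r (length p)" using ij(1) p(1) by (simp add: index_words_append)
    have "l \<in> L p" "c j \<in> L p"
      using i(2) nest[of p i' m] c[OF j(1)] nest[of p j' m] ij p by auto
    then have "infnorm (l - c j) \<le> \<delta> * (s0 powr \<alpha>) ^ length p" using diam[OF pw] by blast
    \<comment> \<open>Cells shrink at the rate \<open>s0 powr \<alpha>\<close>, while the time gaps
      only require the larger rate \<open>s powr \<alpha>\<close>.\<close>
    also have "\<dots> \<le> D * ((1 / real r - s) / 4) powr \<alpha> * (s powr \<alpha>) ^ length p"
      using \<delta> s pos by (intro mult_mono power_mono powr_mono2) auto
    also have "\<dots> = D * ((1 / real r - s) / 4 * s ^ length p) powr \<alpha>"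
      unfolding power_powr_commute[OF s_pos] powr_mult[of "(1 / real r - s) / 4"] by (simp only: mult.assoc)
    also have "\<dots> \<le> D * (real k / real M) powr \<alpha>"
    proof (intro mult_left_mono powr_mono2)
      show "(1 / real r - s) / 4 * s ^ length p \<le> real k / real M"
        using p(3) M by (simp only: k M_def [symmetric] pos_le_divide_eq)
    qed (use s pos in auto)
    also have "\<dots> = D * (real k powr \<alpha> / real M powr \<alpha>)"
      using M by (simp add: powr_divide)
    finally have dist: "infnorm (l - c j) \<le> D * (real k powr \<alpha> / real M powr \<alpha>)" .
    have N2k: "N2 \<le> k" using kN by (simp add: N_def)
    have "norm ((T l ^^ t i) (g j)) \<le> C2 / real k powr \<beta>"
    \<comment> \<open>The order of the two times decides which of the two estimates in (a) is
      used.\<close>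
    proof (cases "t j \<le> t i")
      case True
      then have e: "M = t j + k" "t i = t j + k" by (auto simp: M_def k_def)
      show ?thesis unfolding g_def e(2)
        using N2[OF l\<Lambda> c\<Lambda>[OF j(1)] N2k dist[unfolded e(1)]] by blast
    next
      case False
      then have e: "M = t i + k" "t j = t i + k" by (auto simp: M_def k_def)
      show ?thesis unfolding g_def e(2)
        using N2[OF l\<Lambda> c\<Lambda>[OF j(1)] N2k dist[unfolded e(1)]] by blast
    qed
    also have "\<dots> \<le> C / real k powr \<beta>" using C by (intro divide_right_mono) auto
    finally show ?thesis by (simp add: k powr_minus_divide)
  qed

  have "\<exists>n. norm ((T l ^^ n) y - v) < \<epsilon>" if l: "l \<in> K" for l
  proof -
    obtain i where i: "i \<in> index_words r m" "l \<in> L i" using cover l by blast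
    then have iW: "i \<in> W" by (auto simp: W_def)
    have l\<Lambda>: "l \<in> \<Lambda>" using i cells by blast
    have ti: "N < t i" using t_large[OF i(1)] .
    have lin: "linear (T l ^^ t i)"
      using bounded[OF l\<Lambda>] by (intro linear_funpow) (rule bounded_linear.linear)
    have "(T l ^^ t i) y = (T l ^^ t i) u + (\<Sum>j\<in>W. (T l ^^ t i) (g j))"
      unfolding y_def by (simp add: linear_add[OF lin] linear_sum[OF lin])
    also have "(\<Sum>j\<in>W. (T l ^^ t i) (g j)) = (T l ^^ t i) (g i) + (\<Sum>j\<in>W - {i}. (T l ^^ t i) (g j))"
      using W(1) iW by (rule sum.remove)
    finally have split: "(T l ^^ t i) y - v = (T l ^^ t i) u +
        (((T l ^^ t i) (g i) - v) + (\<Sum>j\<in>W - {i}. (T l ^^ t i) (g j)))"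
      by simp

    \<comment> \<open>The first estimate of (a) with \<open>n = 0\<close>; the single term is then
      absorbed into the total sum.\<close>
    have "norm ((T l ^^ (0 + t i)) ((S l ^^ 0) u)) \<le> C1 / real (t i) powr \<beta>"
      by (rule N1[OF l\<Lambda> l\<Lambda>]) (use ti pos in \<open>auto simp: N_def infnorm_0\<close>)
    also have "\<dots> \<le> C / real (t i) powr \<beta>" using C by (intro divide_right_mono) auto
    also have "\<dots> = C * real (t i) powr (- \<beta>)" by (simp add: powr_minus_divide)
    also have "\<dots> \<le> C * (\<Sum>w \<in> index_words r m. real (t w) powr (- \<beta>))"
      using C i(1) by (intro mult_left_mono member_le_sum) auto
    also have "\<dots> < \<epsilon> / 3" using mult_strict_left_mono[OF t_total C(1)] \<eta> by simp
    finally have 1: "norm ((T l ^^ t i) u) < \<epsilon> / 3" by simp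

    have 2: "norm ((T l ^^ t i) (g i) - v) < \<epsilon> / 3"
      unfolding g_def
    proof (rule b\<tau>)
      have "infnorm (l - c i) \<le> \<delta> * (s0 powr \<alpha>) ^ m"
        using diam[OF i(1) i(2) c[OF iW]] .
      also have "\<dots> \<le> \<tau> / real (t i) powr \<alpha>"
      proof -
        have "(real (t i) * s0 ^ m) powr \<alpha> \<le> ((\<tau> / \<delta>) powr (1 / \<alpha>)) powr \<alpha>"
          using t_small[OF i(1)] pos s by (intro powr_mono2) auto
        also have "\<dots> = \<tau> / \<delta>" using pos \<tau> \<delta> by (simp add: powr_powr)
        finally have "real (t i) powr \<alpha> * (s0 powr \<alpha>) ^ m \<le> \<tau> / \<delta>"
          using s by (simp add: power_powr_commute powr_mult)
        then show ?thesis using ti \<delta> by (simp add: field_simps)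
      qed
      finally show "infnorm (l - c i) \<le> \<tau> / real (t i) powr \<alpha>" .
    qed (use ti l\<Lambda> c\<Lambda>[OF iW] in auto)

    have "norm (\<Sum>j\<in>W - {i}. (T l ^^ t i) (g j))
        \<le> (\<Sum>j\<in>W - {i}. C * \<bar>real (t i) - real (t j)\<bar> powr (- \<beta>))"
      using cross[OF iW i(2)] by (intro sum_norm_le) auto
    also have "\<dots> \<le> (\<Sum>j\<in>index_words r m - {i}. C * \<bar>real (t i) - real (t j)\<bar> powr (- \<beta>))"
      using W C by (intro sum_mono2) auto
    also have "\<dots> < \<epsilon> / 3"
      using mult_strict_left_mono[OF t_sum[OF i(1)] C(1)] \<eta> by (simp add: sum_distrib_left)
    finally have 3: "norm (\<Sum>j\<in>W - {i}. (T l ^^ t i) (g j)) < \<epsilon> / 3" .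

    have "norm (((T l ^^ t i) (g i) - v) + (\<Sum>j\<in>W - {i}. (T l ^^ t i) (g j))) < \<epsilon> / 3 + \<epsilon> / 3"
      using 2 3 by (rule norm_add_less)
    with 1 have "norm ((T l ^^ t i) y - v) < \<epsilon> / 3 + (\<epsilon> / 3 + \<epsilon> / 3)"
      unfolding split by (rule norm_add_less)
    then show ?thesis by (intro exI[of _ "t i"]) simp
  qed
  with y_near show ?thesis by blast
qed

section \<open>From the box dimension to the small pieces\<close>

text \<open>Compactness bounds the differences, so that the supremum is a genuine upper
  bound.\<close>

lemma infnorm_diff_le_sup_diameter:
  fixes A :: "(real ^ 'd) set"
  assumes "compact A" "x \<in> A" "y \<in> A"
  shows "infnorm (x - y) \<le> sup_diameter A"
proof -
  obtain B where B: "\<And>z. z \<in> A \<Longrightarrow> norm z \<le> B"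
    using compact_imp_bounded[OF assms(1)] by (auto simp: bounded_iff)
  have "infnorm (a - b) \<le> B + B" if "a \<in> A" "b \<in> A" for a b
    using infnorm_le_norm[of "a - b"] norm_triangle_ineq4[of a b] B[OF that(1)] B[OF that(2)]
    by linarith
  then have "bdd_above ((\<lambda>(x, y). infnorm (x - y)) ` (A \<times> A))"
    by (intro bdd_aboveI[of _ "B + B"]) auto
  from cSUP_upper[OF _ this, of "(x, y)"] show ?thesis
    using assms by (auto simp: sup_diameter_def)
qed

theorem theorem1p5:
  fixes \<Lambda> :: "(real ^ 'd) set"
    and \<gamma> \<alpha> \<beta> D :: real
    and T :: "real ^ 'd \<Rightarrow> 'a::banach \<Rightarrow> 'a"
    and S :: "real ^ 'd \<Rightarrow> 'a \<Rightarrow> 'a"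
    and \<D> :: "'a set"
  assumes separable: "separable_space (euclidean :: 'a topology)"
    and infinite_dim: "\<nexists>B :: 'a set. finite B \<and> span B = UNIV"
    and "\<gamma> > 0"
    and "compact \<Lambda>"
    and box_dim: "homogeneous_box_dim_at_most \<Lambda> \<gamma>"
    and bounded: "\<And>l. l \<in> \<Lambda> \<Longrightarrow> bounded_linear (T l)"
    and continuous: "continuous_on (\<Lambda> \<times> UNIV) (\<lambda>(l, u). T l u)"
    and dense: "closure \<D> = UNIV"
    and S_maps: "\<And>l u. l \<in> \<Lambda> \<Longrightarrow> u \<in> \<D> \<Longrightarrow> S l u \<in> \<D>"
    and right_inverse: "\<And>l u. l \<in> \<Lambda> \<Longrightarrow> u \<in> \<D> \<Longrightarrow> T l (S l u) = u"
    and "0 < \<alpha>" and "\<alpha> < 1 / \<gamma>" and "\<alpha> * \<gamma> < \<beta>" and "0 < D"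
    and a: "\<And>u. u \<in> \<D> \<Longrightarrow>
      \<exists>C>0. \<exists>N::nat. N > 0 \<and>
        (\<forall>l\<in>\<Lambda>. \<forall>\<mu>\<in>\<Lambda>. \<forall>n k :: nat.
           N \<le> k \<longrightarrow>
           infnorm (l - \<mu>) \<le> D * (real k powr \<alpha> / real (n + k) powr \<alpha>) \<longrightarrow>
           norm ((T l ^^ (n + k)) ((S \<mu> ^^ n) u)) \<le> C / real k powr \<beta> \<and>
           norm ((T l ^^ n) ((S \<mu> ^^ (n + k)) u)) \<le> C / real k powr \<beta>)"
    and b: "\<And>u. u \<in> \<D> \<Longrightarrow>
      \<forall>\<epsilon>>0. \<exists>\<tau>>0. \<forall>n::nat. 1 \<le> n \<longrightarrow>
        (\<forall>l\<in>\<Lambda>. \<forall>\<mu>\<in>\<Lambda>.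
           infnorm (l - \<mu>) \<le> \<tau> / real n powr \<alpha> \<longrightarrow>
           norm ((T l ^^ n) ((S \<mu> ^^ n) u) - u) < \<epsilon>)"
  shows "gdelta (\<Inter>l\<in>\<Lambda>. hypercyclic_vectors (T l)) \<and>
         closure (\<Inter>l\<in>\<Lambda>. hypercyclic_vectors (T l)) = UNIV"
proof -
  obtain r C and L :: "nat list \<Rightarrow> (real ^ 'd) set" where r: "2 \<le> r" and C: "0 < C" and
    L: "\<forall>m\<ge>1.
           (\<forall>k\<in>index_words r m. compact (L k) \<and> L k \<subseteq> \<Lambda>) \<and>
           (\<forall>k\<in>index_words r m. sup_diameter (L k) \<le> C * (1 / real r powr (1 / \<gamma>)) ^ m) \<and>
           \<Lambda> \<subseteq> (\<Union>k\<in>index_words r m. L k) \<and>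
           (\<forall>k\<in>index_words r m. 2 \<le> m \<longrightarrow> L k \<subseteq> L (butlast k))"
    using box_dim unfolding homogeneous_box_dim_at_most_def by blast
  have L_compact: "compact (L w)" and L_sub: "L w \<subseteq> \<Lambda>"
    and L_diam: "sup_diameter (L w) \<le> C * (1 / real r powr (1 / \<gamma>)) ^ m"
    if "w \<in> index_words r m" "1 \<le> m" for w m
    using L that by blast+
  have L_cover: "\<Lambda> \<subseteq> (\<Union>k\<in>index_words r m. L k)" if "1 \<le> m" for m
    using L that by blast
  \<comment> \<open>Iterates the one-letter nesting. Nothing is known about \<open>L []\<close>,
    hence \<open>p \<noteq> []\<close>.\<close>
  have L_nest: "L (p @ q) \<subseteq> L p" if "p @ q \<in> index_words r m" "p \<noteq> []" for p q m
    using that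
  proof (induction q arbitrary: m rule: rev_induct)
    case Nil
    then show ?case by simp
  next
    case (snoc a q)
    have m: "2 \<le> m" "p @ q \<in> index_words r (m - 1)"
      using snoc.prems by (auto simp: index_words_def Suc_le_eq)
    then have "L (p @ q @ [a]) \<subseteq> L (butlast (p @ q @ [a]))"
      using L snoc.prems(1) by (meson one_le_numeral order_trans)
    also have "\<dots> = L (p @ q)" by (simp add: butlast_append)
    finally show ?case using snoc.IH[OF m(2) snoc.prems(2)] by blast
  qed

  \<comment> \<open>Chosen so that \<open>s0 powr \<alpha>\<close> is the ratio of the diameters.
    Then \<open>\<alpha> * \<gamma> < 1\<close> gives \<open>s0 < 1 / real r\<close>, and
    \<open>\<alpha> * \<gamma> < \<beta>\<close> gives
    \<open>real r * s0 powr \<beta> < 1\<close>.\<close>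
  define s0 where "s0 = real r powr (- 1 / (\<alpha> * \<gamma>))"
  have r1: "1 < real r" using r by simp
  have s0: "0 < s0" "s0 < 1 / real r" "real r * s0 powr \<beta> < 1"
    "s0 powr \<alpha> = 1 / real r powr (1 / \<gamma>)" "s0 powr \<alpha> < 1"
  proof -
    show "0 < s0" using r by (simp add: s0_def)
    have "\<alpha> * \<gamma> < 1" using \<open>\<alpha> < 1 / \<gamma>\<close> \<open>\<gamma> > 0\<close> by (simp add: field_simps)
    then have "- 1 / (\<alpha> * \<gamma>) < - 1" using \<open>0 < \<alpha>\<close> \<open>\<gamma> > 0\<close> by (simp add: field_simps)
    then have "s0 < real r powr (- 1)" unfolding s0_def by (intro powr_less_mono r1)
    then show "s0 < 1 / real r" using r by (simp add: powr_minus_divide)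
    have "real r * s0 powr \<beta> = real r powr 1 * real r powr (- 1 / (\<alpha> * \<gamma>) * \<beta>)"
      by (simp only: s0_def powr_powr) simp
    also have "\<dots> = real r powr (1 - \<beta> / (\<alpha> * \<gamma>))"
      by (simp only: powr_add [symmetric]) simp
    also have "\<dots> < 1"
      using \<open>\<alpha> * \<gamma> < \<beta>\<close> \<open>0 < \<alpha>\<close> \<open>\<gamma> > 0\<close> r1 by (simp add: powr_less_one)
    finally show "real r * s0 powr \<beta> < 1" .
    show *: "s0 powr \<alpha> = 1 / real r powr (1 / \<gamma>)"
    proof -
      have "s0 powr \<alpha> = real r powr (- 1 / (\<alpha> * \<gamma>) * \<alpha>)"
        by (simp only: s0_def powr_powr)
      also have "- 1 / (\<alpha> * \<gamma>) * \<alpha> = - (1 / \<gamma>)" using \<open>0 < \<alpha>\<close> by simp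
      finally show ?thesis by (simp only: powr_minus_divide)
    qed
    show "s0 powr \<alpha> < 1"
      unfolding * using r1 \<open>\<gamma> > 0\<close> by (simp add: gr_one_powr)
  qed
  define s where "s = (s0 + 1 / real r) / 2"
  have s: "s0 < s" "s < 1 / real r" using s0 by (auto simp: s_def field_simps)

  have "(\<lambda>m. C * (s0 powr \<alpha>) ^ m) \<longlonglongrightarrow> 0"
    using s0 by (intro tendsto_mult_right_zero LIMSEQ_power_zero) auto
  moreover have "0 < D * ((1 / real r - s) / 4) powr \<alpha>" using \<open>0 < D\<close> s by simp
  ultimately have "\<forall>\<^sub>F m in sequentially. C * (s0 powr \<alpha>) ^ m < D * ((1 / real r - s) / 4) powr \<alpha>"
    by (rule order_tendstoD(2))
  then have "\<forall>\<^sub>F m in sequentially. C * (s0 powr \<alpha>) ^ m < D * ((1 / real r - s) / 4) powr \<alpha> \<and> 1 \<le> m"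
    using eventually_ge_at_top[of 1] by eventually_elim auto
  \<comment> \<open>At this depth the cells are small enough for
    \<open>approximation_on_small_piece\<close>; \<open>1 \<le> m0\<close> keeps the words
    nonempty.\<close>
  then obtain m0 where m0: "C * (s0 powr \<alpha>) ^ m0 < D * ((1 / real r - s) / 4) powr \<alpha>" "1 \<le> m0"
    by (auto simp: eventually_sequentially)

  text \<open>The cell \<open>L w\<close> itself need not be covered by its own subcells, hence the intersection.\<close>
  define U where "U w m = (\<Union>k\<in>index_words r m. L (w @ k))" for w m
  define \<K> where "\<K> = (\<lambda>w. \<Inter>m. U w m) ` index_words r m0"
  have app: "w @ k \<in> index_words r (m0 + m)" if "w \<in> index_words r m0" "k \<in> index_words r m" for w k m
    using that by (auto simp: index_words_def)
  have ne: "w \<noteq> []" if "w \<in> index_words r m0" for w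
    using that m0(2) by (auto simp: index_words_def)
  have U_compact: "compact (U w m)" if "w \<in> index_words r m0" for w m
    using L_compact[OF app[OF that]] m0(2) by (auto simp: U_def intro!: compact_UN)
  have U_sub: "U w m \<subseteq> \<Lambda>" if "w \<in> index_words r m0" for w m
    using L_sub[OF app[OF that]] m0(2) unfolding U_def by (intro UN_least) auto
  have U_decreasing: "U w m' \<subseteq> U w m" if w: "w \<in> index_words r m0" and "m \<le> m'" for w m m'
  proof
    fix l assume "l \<in> U w m'"
    then obtain k where k: "k \<in> index_words r m'" "l \<in> L (w @ k)" by (auto simp: U_def)
    have "take m k \<in> index_words r m"
      using k(1) \<open>m \<le> m'\<close> by (auto simp: index_words_def dest: in_set_takeD)
    moreover have "L ((w @ take m k) @ drop m k) \<subseteq> L (w @ take m k)"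
      by (rule L_nest[of _ _ "m0 + m'"]) (use app[OF w k(1)] ne[OF w] in auto)
    ultimately show "l \<in> U w m" using k(2) by (auto simp: U_def)
  qed
  \<comment> \<open>Were \<open>l\<close> outside every piece, each of the finitely many words
    \<open>w\<close> would fail at some level, hence by monotonicity at the largest such level
    \<open>m\<close>. The cover at depth \<open>m0 + m\<close> contradicts this for the prefix of a
    word whose cell contains \<open>l\<close>.\<close>
  have "l \<in> \<Union>\<K>" if l: "l \<in> \<Lambda>" for l
  proof (rule ccontr)
    assume "l \<notin> \<Union>\<K>"
    then have "\<forall>w\<in>index_words r m0. \<exists>m. l \<notin> U w m" by (auto simp: \<K>_def)
    then obtain f where f: "\<And>w. w \<in> index_words r m0 \<Longrightarrow> l \<notin> U w (f w)" by metis
    define m where "m = Max (f ` index_words r m0)"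
    obtain k where k: "k \<in> index_words r (m0 + m)" "l \<in> L k"
      using L_cover[of "m0 + m"] l m0(2) by auto
    have w: "take m0 k \<in> index_words r m0" and "drop m0 k \<in> index_words r m"
      using k(1) by (auto simp: index_words_def dest: in_set_takeD in_set_dropD)
    then have "l \<in> U (take m0 k) m" using k(2) by (auto simp: U_def intro!: bexI[of _ "drop m0 k"])
    moreover have "f (take m0 k) \<le> m" unfolding m_def using w by (intro Max_ge) auto
    ultimately show False using f[OF w] U_decreasing[OF w] by blast
  qed
  then have \<Lambda>: "\<Union>\<K> = \<Lambda>"
    using U_sub by (fastforce simp: \<K>_def)

  have "gdelta (\<Inter>l\<in>\<Union>\<K>. hypercyclic_vectors (T l)) \<and>
        closure (\<Inter>l\<in>\<Union>\<K>. hypercyclic_vectors (T l)) = UNIV"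
  proof (rule common_hypercyclicity_criterion[OF separable _ _ _ dense])
    show "continuous_on (\<Union>\<K> \<times> UNIV) (\<lambda>(l, u). T l u)" using continuous by (simp add: \<Lambda>)
    show "countable \<K>" by (simp add: \<K>_def countable_finite)
    show "compact K" if "K \<in> \<K>" for K
      using that U_compact unfolding \<K>_def by (auto intro!: compact_Inter)
  next
    fix K u v and \<epsilon> :: real assume K: "K \<in> \<K>" and uv: "u \<in> \<D>" "v \<in> \<D>" and \<epsilon>: "0 < \<epsilon>"
    obtain w where w: "w \<in> index_words r m0" "K = (\<Inter>m. U w m)" using K by (auto simp: \<K>_def)
    \<comment> \<open>The cells below \<open>w\<close> form a family of the same kind, with the
      first \<open>m0\<close> contractions moved into the constant \<open>\<delta>\<close>.\<close>
    show "\<exists>y. norm (y - u) < \<epsilon> \<and> (\<forall>l\<in>K. \<exists>n. norm ((T l ^^ n) y - v) < \<epsilon>)"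
    proof (rule approximation_on_small_piece[where r = r and s = s and ?s0.0 = s0 and \<alpha> = \<alpha> and \<beta> = \<beta>
          and D = D and \<Lambda> = \<Lambda> and \<delta> = "C * (s0 powr \<alpha>) ^ m0" and L = "\<lambda>k. L (w @ k)" and S = S])
      show "L (w @ k) \<subseteq> \<Lambda>" if "k \<in> index_words r m" for k m
        using L_sub[OF app[OF w(1) that]] m0(2) by simp
      show "L (w @ p @ q) \<subseteq> L (w @ p)" if "p @ q \<in> index_words r m" for p q m
        using L_nest[of "w @ p" q "m0 + m"] app[OF w(1) that] ne[OF w(1)] by simp
      show "K \<subseteq> (\<Union>k\<in>index_words r m. L (w @ k))" for m
        unfolding w(2) U_def by blast
      show "infnorm (x - y) \<le> C * (s0 powr \<alpha>) ^ m0 * (s0 powr \<alpha>) ^ m"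
        if k: "k \<in> index_words r m" and xy: "x \<in> L (w @ k)" "y \<in> L (w @ k)" for m k x y
      proof -
        have "infnorm (x - y) \<le> sup_diameter (L (w @ k))"
          using L_compact[OF app[OF w(1) k]] m0(2) xy by (intro infnorm_diff_le_sup_diameter) auto
        also have "\<dots> \<le> C * (s0 powr \<alpha>) ^ (m0 + m)"
          unfolding s0(4) using L_diam[OF app[OF w(1) k]] m0(2) by simp
        finally show ?thesis by (simp add: power_add mult.assoc)
      qed
      show "0 < \<beta>"
        using \<open>\<alpha> * \<gamma> < \<beta>\<close> mult_pos_pos[OF \<open>0 < \<alpha>\<close> \<open>\<gamma> > 0\<close>] by linarith
      show "\<exists>\<tau>>0. \<forall>n\<ge>1. \<forall>l\<in>\<Lambda>. \<forall>\<mu>\<in>\<Lambda>. infnorm (l - \<mu>) \<le> \<tau> / real n powr \<alpha> \<longrightarrow>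
          norm ((T l ^^ n) ((S \<mu> ^^ n) v) - v) < e" if "0 < e" for e
        using b[OF uv(2)] that by blast
    next
      fix z assume "z \<in> {u, v}"
      then have "z \<in> \<D>" using uv by blast
      then show "\<exists>C>0. \<exists>N::nat. N > 0 \<and>
        (\<forall>l\<in>\<Lambda>. \<forall>\<mu>\<in>\<Lambda>. \<forall>n k :: nat. N \<le> k \<longrightarrow>
           infnorm (l - \<mu>) \<le> D * (real k powr \<alpha> / real (n + k) powr \<alpha>) \<longrightarrow>
           norm ((T l ^^ (n + k)) ((S \<mu> ^^ n) z)) \<le> C / real k powr \<beta> \<and>
           norm ((T l ^^ n) ((S \<mu> ^^ (n + k)) z)) \<le> C / real k powr \<beta>)"
        by (rule a)
    qed (use m0 C s0 s r \<epsilon> \<open>0 < \<alpha>\<close> \<open>0 < D\<close> bounded in auto)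
  qed
  then show ?thesis by (simp only: \<Lambda>)
qed

end
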